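(* Let $p$ be a prime and let $A_1$ and $A_2$ be reduced Abelian $p$-groups whose basic subgroups are countable. If $\mathrm{Th}_2^{\omega}(A_1)=\mathrm{Th}_2^{\omega}(A_2)$, then the endomorphism rings $\mathrm{End}(A_1)$ and $\mathrm{End}(A_2)$ are elementarily equivalent, i.e. satisfy the same first order sentences of the ring language.
   Context: Basic subgroup of an Abelian $p$-group $A$: a subgroup $B$ that is a direct sum of cyclic groups, is pure in $A$ ($nB=B\cap nA$ for all $n\in\mathbb Z$), and has $A/B$ divisible. A set is called countable if its cardinality is $\omega$. $\mathcal L_2$ is the second order language of Abelian groups, with equality and a ternary relation symbol for $x_1=x_2+x_3$, in which one may quantify over group elements and over $n$-ary relation (predicate) variables for every $n\ge 1$. For a cardinal $\varkappa$, $\mathrm{Th}_2^{\varkappa}(A)$ is the set of sentences of $\mathcal L_2$ that are true in $A$ when every $n$-ary predicate variable is interpreted as ranging over subsets $b\subseteq A^n$ with $|b|\le\varkappa$ (object variables range over $A$). The ring $\mathrm{End}(A)$ is the ring of endomorphisms of $A$ under pointwise addition and composition, regarded as a structure for the first order ring language (equality, addition, multiplication). *)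

theory Defs
  imports "HOL-Algebra.Algebra"
begin

unbundle cardinal_syntax

(* Abelian groups are HOL-Algebra's comm_group and hence written multiplicatively:
   the sum of x and y is x \<otimes> y, the multiple n x is x [^] n, and zero is \<one>. *)

section \<open>Abelian groups\<close>

definition p_group :: "nat \<Rightarrow> ('a, 'm) monoid_scheme \<Rightarrow> bool" where
  "p_group p A \<longleftrightarrow> (\<forall>x\<in>carrier A. \<exists>k. group.ord A x = p ^ k)"

definition divisible_group :: "('a, 'm) monoid_scheme \<Rightarrow> bool" where
  "divisible_group A \<longleftrightarrow>
     (\<forall>n::nat. n > 0 \<longrightarrow> (\<forall>x\<in>carrier A. \<exists>y\<in>carrier A. y [^]\<^bsub>A\<^esub> n = x))"

definition reduced_group :: "('a, 'm) monoid_scheme \<Rightarrow> bool" where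
  "reduced_group A \<longleftrightarrow>
     (\<forall>D. subgroup D A \<and> divisible_group (A\<lparr>carrier := D\<rparr>) \<longrightarrow> D = {\<one>\<^bsub>A\<^esub>})"

(* The index set and the summands live in the type of G.  This loses no generality: a summand
   is isomorphic to a subgroup of G, trivial summands may be dropped, and the remaining
   summands are indexed injectively by generators of their images in G. *)
definition direct_sum_of_cyclic_groups :: "('a, 'm) monoid_scheme \<Rightarrow> bool" where
  "direct_sum_of_cyclic_groups G \<longleftrightarrow>
     (\<exists>(I::'a set) (C::'a \<Rightarrow> 'a monoid).
        (\<forall>i\<in>I. group (C i) \<and> cyclic_group (C i)) \<and> sum_group I C \<cong> G)"

definition pure_subgroup :: "'a set \<Rightarrow> ('a, 'm) monoid_scheme \<Rightarrow> bool" where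
  "pure_subgroup B A \<longleftrightarrow> subgroup B A \<and>
     (\<forall>n::int. (\<lambda>x. x [^]\<^bsub>A\<^esub> n) ` B = B \<inter> (\<lambda>x. x [^]\<^bsub>A\<^esub> n) ` carrier A)"

definition basic_subgroup :: "'a set \<Rightarrow> ('a, 'm) monoid_scheme \<Rightarrow> bool" where
  "basic_subgroup B A \<longleftrightarrow>
     subgroup B A \<and> direct_sum_of_cyclic_groups (A\<lparr>carrier := B\<rparr>) \<and>
     pure_subgroup B A \<and> divisible_group (A Mod B)"


section \<open>The second order language of Abelian groups\<close>

(* Add x y z stands for x = y + z.  Predicate variables are named by their arity n and an
   index k, so that P n k xs is the k-th predicate variable of arity n applied to xs. *)
datatype so_form =
    SO_Eq nat nat
  | SO_Add nat nat nat
  | SO_Pred nat nat "nat list"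
  | SO_Neg so_form
  | SO_Conj so_form so_form
  | SO_Ex nat so_form
  | SO_ExPred nat nat so_form

primrec so_wf :: "so_form \<Rightarrow> bool" where
  "so_wf (SO_Eq x y) = True"
| "so_wf (SO_Add x y z) = True"
| "so_wf (SO_Pred n k xs) = (n \<ge> 1 \<and> length xs = n)"
| "so_wf (SO_Neg \<phi>) = so_wf \<phi>"
| "so_wf (SO_Conj \<phi> \<psi>) = (so_wf \<phi> \<and> so_wf \<psi>)"
| "so_wf (SO_Ex x \<phi>) = so_wf \<phi>"
| "so_wf (SO_ExPred n k \<phi>) = (n \<ge> 1 \<and> so_wf \<phi>)"

primrec so_free_obj :: "so_form \<Rightarrow> nat set" where
  "so_free_obj (SO_Eq x y) = {x, y}"
| "so_free_obj (SO_Add x y z) = {x, y, z}"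
| "so_free_obj (SO_Pred n k xs) = set xs"
| "so_free_obj (SO_Neg \<phi>) = so_free_obj \<phi>"
| "so_free_obj (SO_Conj \<phi> \<psi>) = so_free_obj \<phi> \<union> so_free_obj \<psi>"
| "so_free_obj (SO_Ex x \<phi>) = so_free_obj \<phi> - {x}"
| "so_free_obj (SO_ExPred n k \<phi>) = so_free_obj \<phi>"

primrec so_free_pred :: "so_form \<Rightarrow> (nat \<times> nat) set" where
  "so_free_pred (SO_Eq x y) = {}"
| "so_free_pred (SO_Add x y z) = {}"
| "so_free_pred (SO_Pred n k xs) = {(n, k)}"
| "so_free_pred (SO_Neg \<phi>) = so_free_pred \<phi>"
| "so_free_pred (SO_Conj \<phi> \<psi>) = so_free_pred \<phi> \<union> so_free_pred \<psi>"
| "so_free_pred (SO_Ex x \<phi>) = so_free_pred \<phi>"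
| "so_free_pred (SO_ExPred n k \<phi>) = so_free_pred \<phi> - {(n, k)}"

definition so_sentence :: "so_form \<Rightarrow> bool" where
  "so_sentence \<phi> \<longleftrightarrow> so_wf \<phi> \<and> so_free_obj \<phi> = {} \<and> so_free_pred \<phi> = {}"

(* The cardinal bound \<kappa> on the interpretations of predicate variables is a cardinal in the
   sense of HOL's cardinal theory, i.e. a well-order relation; natLeq is \<omega>. *)
primrec so_sat ::
  "'k rel \<Rightarrow> ('a, 'm) monoid_scheme \<Rightarrow> so_form \<Rightarrow> (nat \<Rightarrow> 'a) \<Rightarrow> (nat \<Rightarrow> nat \<Rightarrow> 'a list set) \<Rightarrow> bool"
where
  "so_sat \<kappa> A (SO_Eq x y) v P = (v x = v y)"
| "so_sat \<kappa> A (SO_Add x y z) v P = (v x = v y \<otimes>\<^bsub>A\<^esub> v z)"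
| "so_sat \<kappa> A (SO_Pred n k xs) v P = (map v xs \<in> P n k)"
| "so_sat \<kappa> A (SO_Neg \<phi>) v P = (\<not> so_sat \<kappa> A \<phi> v P)"
| "so_sat \<kappa> A (SO_Conj \<phi> \<psi>) v P = (so_sat \<kappa> A \<phi> v P \<and> so_sat \<kappa> A \<psi> v P)"
| "so_sat \<kappa> A (SO_Ex x \<phi>) v P = (\<exists>a\<in>carrier A. so_sat \<kappa> A \<phi> (v(x := a)) P)"
| "so_sat \<kappa> A (SO_ExPred n k \<phi>) v P =
     (\<exists>b. b \<subseteq> {as. length as = n \<and> set as \<subseteq> carrier A} \<and> |b| \<le>o \<kappa> \<and>
          so_sat \<kappa> A \<phi> v (P(n := (P n)(k := b))))"

(* The truth value of a sentence does not depend on the assignment. *)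
definition so_true :: "'k rel \<Rightarrow> ('a, 'm) monoid_scheme \<Rightarrow> so_form \<Rightarrow> bool" where
  "so_true \<kappa> A \<phi> \<longleftrightarrow> (\<forall>v P. range v \<subseteq> carrier A \<longrightarrow> so_sat \<kappa> A \<phi> v P)"

definition Th2 :: "'k rel \<Rightarrow> ('a, 'm) monoid_scheme \<Rightarrow> so_form set" where
  "Th2 \<kappa> A = {\<phi>. so_sentence \<phi> \<and> so_true \<kappa> A \<phi>}"


section \<open>The first order language of rings\<close>

datatype ring_trm = R_Var nat | R_Add ring_trm ring_trm | R_Mult ring_trm ring_trm

datatype ring_form =
    R_Eq ring_trm ring_trm
  | R_Neg ring_form
  | R_Conj ring_form ring_form
  | R_Ex nat ring_form

primrec ring_trm_vars :: "ring_trm \<Rightarrow> nat set" where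
  "ring_trm_vars (R_Var x) = {x}"
| "ring_trm_vars (R_Add s t) = ring_trm_vars s \<union> ring_trm_vars t"
| "ring_trm_vars (R_Mult s t) = ring_trm_vars s \<union> ring_trm_vars t"

primrec ring_form_free :: "ring_form \<Rightarrow> nat set" where
  "ring_form_free (R_Eq s t) = ring_trm_vars s \<union> ring_trm_vars t"
| "ring_form_free (R_Neg \<phi>) = ring_form_free \<phi>"
| "ring_form_free (R_Conj \<phi> \<psi>) = ring_form_free \<phi> \<union> ring_form_free \<psi>"
| "ring_form_free (R_Ex x \<phi>) = ring_form_free \<phi> - {x}"

definition ring_sentence :: "ring_form \<Rightarrow> bool" where
  "ring_sentence \<phi> \<longleftrightarrow> ring_form_free \<phi> = {}"

primrec ring_trm_val :: "('a, 'm) ring_scheme \<Rightarrow> (nat \<Rightarrow> 'a) \<Rightarrow> ring_trm \<Rightarrow> 'a" where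
  "ring_trm_val R v (R_Var x) = v x"
| "ring_trm_val R v (R_Add s t) = ring_trm_val R v s \<oplus>\<^bsub>R\<^esub> ring_trm_val R v t"
| "ring_trm_val R v (R_Mult s t) = ring_trm_val R v s \<otimes>\<^bsub>R\<^esub> ring_trm_val R v t"

primrec ring_sat :: "('a, 'm) ring_scheme \<Rightarrow> ring_form \<Rightarrow> (nat \<Rightarrow> 'a) \<Rightarrow> bool" where
  "ring_sat R (R_Eq s t) v = (ring_trm_val R v s = ring_trm_val R v t)"
| "ring_sat R (R_Neg \<phi>) v = (\<not> ring_sat R \<phi> v)"
| "ring_sat R (R_Conj \<phi> \<psi>) v = (ring_sat R \<phi> v \<and> ring_sat R \<psi> v)"
| "ring_sat R (R_Ex x \<phi>) v = (\<exists>a\<in>carrier R. ring_sat R \<phi> (v(x := a)))"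

definition ring_true :: "('a, 'm) ring_scheme \<Rightarrow> ring_form \<Rightarrow> bool" where
  "ring_true R \<phi> \<longleftrightarrow> (\<forall>v. range v \<subseteq> carrier R \<longrightarrow> ring_sat R \<phi> v)"

definition elementarily_equivalent ::
  "('a, 'm) ring_scheme \<Rightarrow> ('b, 'n) ring_scheme \<Rightarrow> bool" where
  "elementarily_equivalent R S \<longleftrightarrow>
     (\<forall>\<phi>. ring_sentence \<phi> \<longrightarrow> (ring_true R \<phi> \<longleftrightarrow> ring_true S \<phi>))"


section \<open>The endomorphism ring\<close>

(* Endomorphisms are taken to be undefined outside the carrier, so that equality of functions
   is equality of endomorphisms. *)
definition End_ring :: "('a, 'm) monoid_scheme \<Rightarrow> ('a \<Rightarrow> 'a) ring" where
  "End_ring A =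
     \<lparr>carrier = hom A A \<inter> extensional (carrier A),
      monoid.mult = compose (carrier A),
      monoid.one = (\<lambda>x\<in>carrier A. x),
      ring.zero = (\<lambda>x\<in>carrier A. \<one>\<^bsub>A\<^esub>),
      ring.add = (\<lambda>f g. \<lambda>x\<in>carrier A. f x \<otimes>\<^bsub>A\<^esub> g x)\<rparr>"

lemma ring_End_ring:
  assumes "comm_group A"
  shows "ring (End_ring A)"
proof -
  interpret comm_group A by fact
  have add: "abelian_group (End_ring A)"
  proof (rule abelian_groupI)
    fix f assume f: "f \<in> carrier (End_ring A)"
    define g where "g = (\<lambda>x\<in>carrier A. inv\<^bsub>A\<^esub> f x)"
    have "g \<in> carrier (End_ring A)"
      using f by (auto simp: g_def End_ring_def hom_def Pi_def inv_mult)
    moreover have "g \<oplus>\<^bsub>End_ring A\<^esub> f = \<zero>\<^bsub>End_ring A\<^esub>"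
      using f by (auto simp: g_def End_ring_def hom_def Pi_def fun_eq_iff)
    ultimately show "\<exists>g\<in>carrier (End_ring A). g \<oplus>\<^bsub>End_ring A\<^esub> f = \<zero>\<^bsub>End_ring A\<^esub>"
      by blast
  qed (auto simp: End_ring_def hom_def Pi_def fun_eq_iff m_ac extensional_def)
  have mult: "monoid (End_ring A)"
    by (rule monoidI)
      (auto simp: End_ring_def hom_def Pi_def fun_eq_iff extensional_def compose_def)
  show ?thesis
    by (rule ringI[OF add mult])
      (auto simp: End_ring_def hom_def Pi_def fun_eq_iff compose_def)
qed

end

theory Submission
  imports Defs
begin

text \<open>
  An endomorphism \<open>F\<close> of a reduced \<open>p\<close>-group \<open>A\<close> is determined by its restriction to any subset \<open>B\<close>
  with \<open>A = p A + B\<close>: every element expands as \<open>a = u\<^sub>0 + p u\<^sub>1 + p\<^sup>2 u\<^sub>2 + \<dots>\<close> with the \<open>u\<^sub>i\<close> in \<open>B\<close>, in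
  the sense of a sequence of remainders, and two endomorphisms that agree on \<open>B\<close> differ by a map
  with divisible image.  When \<open>B\<close> is countable, \<open>F\<close> is thus coded by the countable relation
  \<open>{(u, F u). u \<in> B}\<close>, and the statement \<open>F a = b\<close> becomes: some countable set of pairs contains
  \<open>(a, b)\<close>, and each of its members is \<open>p\<close> times another member plus a pair from the code.  This
  does not mention \<open>B\<close> and is expressible with predicates of size at most \<open>\<omega>\<close>
  (\<open>codes_imp_value\<close>, \<open>codes_value\<close>).

  So the endomorphism ring is interpreted in the restricted second order theory, uniformly for all
  groups with the same \<open>p\<close>: ring variables become binary predicates, ring terms are evaluated
  pointwise, and a quantifier over ring elements becomes a quantifier over predicates that code an
  endomorphism (\<open>so_sat_of_ring\<close>).  Groups with equal theories therefore have elementarily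
  equivalent endomorphism rings.

  A countable \<open>B\<close> is supplied by a basic subgroup, for which \<open>A = p A + B\<close> holds because \<open>A / B\<close> is
  divisible.  The countability hypothesis speaks about all basic subgroups, so it has content only
  once one is known to exist (\<open>ex_basic_subgroup\<close>).  This is Kulikov's theorem: Zorn's lemma gives
  a maximal pure independent set, and if the quotient by its span were not divisible, an element of
  finite height in the socle of the quotient could be lifted and added to the set
  (\<open>finite_height_mod_pure_span\<close>, \<open>pure_independent_insert\<close>).
\<close>

section \<open>Divisibility in abelian p-groups\<close>

text \<open>Torsion is stated by powers that kill rather than by orders: in this form it passes to
  subgroups and quotients without computing any order.\<close>
locale abelian_p_group = comm_group G for G (structure) +
  fixes p :: nat
  assumes prime_p: "Factorial_Ring.prime p"
    and p_torsion: "x \<in> carrier G \<Longrightarrow> \<exists>k. x [^] (p ^ k) = \<one>"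

lemma abelian_p_groupI:
  assumes "Factorial_Ring.prime p" "comm_group A" "p_group p A"
  shows "abelian_p_group A p"
proof -
  interpret comm_group A by fact
  show ?thesis
  proof unfold_locales
    fix x assume "x \<in> carrier A"
    then show "\<exists>k. x [^]\<^bsub>A\<^esub> (p ^ k) = \<one>\<^bsub>A\<^esub>"
      using assms(3) pow_ord_eq_1 unfolding p_group_def by metis
  qed fact
qed

context abelian_p_group
begin

lemma p_pos: "p > 0"
  using prime_p by (simp add: prime_gt_0_nat)

lemma coprime_root:
  assumes x: "x \<in> carrier G" "x [^] (p ^ k) = \<one>" and m: "\<not> p dvd m"
  shows "\<exists>r. x [^] (m * r) = x"
proof -
  have "m \<noteq> 0" using m by (metis dvd_0_right)
  moreover have "coprime m (p ^ k)"
    using m prime_p by (metis coprime_commute coprime_power_right_iff prime_imp_coprime)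
  ultimately obtain r s where "m * r = p ^ k * s + 1"
    using bezout_nat[of m "p ^ k"] by auto
  then have "x [^] (m * r) = (x [^] (p ^ k)) [^] s \<otimes> x"
    using x(1) by (simp add: nat_pow_pow)
  then show ?thesis using x by auto
qed

text \<open>Raising to a power prime to \<open>p\<close> is invertible on the cyclic group generated by any element,
  so divisibility is only a question about \<open>p\<close>.\<close>
lemma divisible_if_p_divisible:
  assumes "\<And>x. x \<in> carrier G \<Longrightarrow> \<exists>y\<in>carrier G. y [^] p = x"
  shows "divisible_group G"
  unfolding divisible_group_def
proof (intro allI impI ballI)
  fix n :: nat and x assume n: "n > 0" and x: "x \<in> carrier G"
  have root: "\<exists>y\<in>carrier G. y [^] (p ^ e) = x" for e
  proof (induction e)
    case 0
    show ?case using x by auto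
  next
    case (Suc e)
    then obtain y where y: "y \<in> carrier G" "y [^] (p ^ e) = x" by blast
    obtain z where "z \<in> carrier G" "z [^] p = y" using assms y(1) by blast
    with y show ?case by (auto simp: nat_pow_pow intro!: bexI[of _ z])
  qed
  obtain e m where nm: "n = p ^ e * m" "\<not> p dvd m"
    using n prime_p
    by (metis mult.commute multiplicity_decompose' neq0_conv not_prime_unit)
  obtain y where y: "y \<in> carrier G" "y [^] (p ^ e) = x" using root by blast
  obtain k where "y [^] (p ^ k) = \<one>" using p_torsion y(1) by blast
  then obtain r where r: "y [^] (m * r) = y" using coprime_root y(1) nm(2) by blast
  have "(y [^] r) [^] n = (y [^] (m * r)) [^] (p ^ e)"
    using y(1) by (simp add: nat_pow_pow nm(1) mult_ac)
  then have "(y [^] r) [^] n = x" using r y by simp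
  then show "\<exists>y\<in>carrier G. y [^] n = x" using y(1) by blast
qed

lemma abelian_p_group_subgroup:
  assumes "subgroup D G"
  shows "abelian_p_group (G\<lparr>carrier := D\<rparr>) p"
proof -
  interpret D: comm_group "G\<lparr>carrier := D\<rparr>"
    by (rule group.group_comm_groupI[OF subgroup_imp_group[OF assms]])
      (use subgroup.mem_carrier[OF assms] m_comm in auto)
  show ?thesis
    by unfold_locales
      (use p_torsion subgroup.mem_carrier[OF assms] prime_p in \<open>auto simp flip: nat_pow_consistent\<close>)
qed

lemma divisible_subgroup_trivial:
  assumes red: "reduced_group G" and D: "subgroup D G"
    and div: "\<And>x. x \<in> D \<Longrightarrow> \<exists>y\<in>D. y [^] p = x"
  shows "D = {\<one>}"
proof -
  interpret D: abelian_p_group "G\<lparr>carrier := D\<rparr>" p by (rule abelian_p_group_subgroup[OF D])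
  have "divisible_group (G\<lparr>carrier := D\<rparr>)"
    by (rule D.divisible_if_p_divisible) (use div in \<open>auto simp flip: nat_pow_consistent\<close>)
  then show ?thesis using red D unfolding reduced_group_def by blast
qed

lemma generate_p_divisible:
  assumes H: "H \<subseteq> carrier G" and div: "\<And>x. x \<in> H \<Longrightarrow> \<exists>y\<in>H. y [^] p = x"
    and x: "x \<in> generate G H"
  shows "\<exists>y\<in>generate G H. y [^] p = x"
  using x
proof (induction rule: generate.induct)
  case one
  show ?case by (rule bexI[of _ \<one>]) (auto intro: generate.one)
next
  case (incl h)
  then show ?case using div generate.incl by metis
next
  case (inv h)
  then obtain y where "y \<in> H" "y [^] p = h" using div by blast
  then show ?case using H by (auto intro!: bexI[of _ "inv y"] generate.inv simp: nat_pow_inv subsetD)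
next
  case (eng a b)
  then obtain y z where "y \<in> generate G H" "z \<in> generate G H" "y [^] p = a" "z [^] p = b" by blast
  moreover from this have "y \<in> carrier G" "z \<in> carrier G" using generate_incl[OF H] by blast+
  ultimately show ?case by (metis generate.eng nat_pow_distrib)
qed

text \<open>The form in which reducedness is applied: the subgroup generated by a \<open>p\<close>-divisible set is
  itself \<open>p\<close>-divisible, hence divisible, hence trivial.\<close>
lemma p_divisible_subset_trivial:
  assumes red: "reduced_group G" and H: "H \<subseteq> carrier G"
    and div: "\<And>x. x \<in> H \<Longrightarrow> \<exists>y\<in>H. y [^] p = x"
  shows "H \<subseteq> {\<one>}"
  using divisible_subgroup_trivial[OF red generate_is_subgroup[OF H] generate_p_divisible[OF H div]]
    generate.incl[of _ H G] by blast

end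

section \<open>Existence of basic subgroups\<close>

context abelian_p_group
begin

definition lincomb :: "('a \<Rightarrow> nat) \<Rightarrow> 'a set \<Rightarrow> 'a" where
  "lincomb c Y = (\<Otimes>y\<in>Y. y [^] c y)"

text \<open>Natural coefficients already give the whole generated subgroup, because every element has
  finite order.\<close>
definition nat_span :: "'a set \<Rightarrow> 'a set" where
  "nat_span S = {lincomb c Y | c Y. finite Y \<and> Y \<subseteq> S}"

text \<open>Independence and purity of the span in one condition.  For \<open>a = \<one>\<close> and \<open>k\<close> large it makes every
  summand of a vanishing combination vanish.  For arbitrary \<open>a\<close> it yields a \<open>p\<^sup>k\<close>-th root inside
  the span, with coefficients \<open>d\<close>.  It concerns finite subsets only, so it survives unions of
  chains.\<close>
definition pure_independent :: "'a set \<Rightarrow> bool" where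
  "pure_independent S \<longleftrightarrow> S \<subseteq> carrier G \<and>
     (\<forall>Y c k a. finite Y \<and> Y \<subseteq> S \<and> a \<in> carrier G \<and> lincomb c Y = a [^] (p ^ k) \<longrightarrow>
        (\<forall>y\<in>Y. \<exists>d. y [^] c y = y [^] (p ^ k * d)))"

lemma nat_spanI: "finite Y \<Longrightarrow> Y \<subseteq> S \<Longrightarrow> lincomb c Y \<in> nat_span S"
  unfolding nat_span_def by blast

lemma nat_spanE:
  assumes "a \<in> nat_span S"
  obtains c Y where "finite Y" "Y \<subseteq> S" "a = lincomb c Y"
  using assms unfolding nat_span_def by blast

lemma pure_independentD:
  assumes "pure_independent S" "finite Y" "Y \<subseteq> S" "a \<in> carrier G" "lincomb c Y = a [^] (p ^ k)"
    "y \<in> Y"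
  shows "\<exists>d. y [^] c y = y [^] (p ^ k * d)"
  using assms unfolding pure_independent_def by blast

lemma lincomb_closed: "Y \<subseteq> carrier G \<Longrightarrow> lincomb c Y \<in> carrier G"
  unfolding lincomb_def by (rule finprod_closed) auto

lemma lincomb_insert:
  "finite Y \<Longrightarrow> y \<notin> Y \<Longrightarrow> y \<in> carrier G \<Longrightarrow> Y \<subseteq> carrier G \<Longrightarrow>
     lincomb c (insert y Y) = y [^] c y \<otimes> lincomb c Y"
  unfolding lincomb_def by (rule finprod_insert) auto

lemma lincomb_power:
  assumes "finite Y" "Y \<subseteq> carrier G"
  shows "lincomb c Y [^] n = lincomb (\<lambda>y. n * c y) Y"
  using assms
proof (induction Y rule: finite_induct)
  case empty
  show ?case by (simp add: lincomb_def)
next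
  case (insert y Y)
  then show ?case
    by (simp add: lincomb_insert nat_pow_distrib lincomb_closed nat_pow_pow mult.commute)
qed

lemma lincomb_cong:
  "(\<And>y. y \<in> Y \<Longrightarrow> y [^] c y = y [^] d y) \<Longrightarrow> Y \<subseteq> carrier G \<Longrightarrow> lincomb c Y = lincomb d Y"
  unfolding lincomb_def by (rule finprod_cong') auto

lemma span_closed: "S \<subseteq> carrier G \<Longrightarrow> nat_span S \<subseteq> carrier G"
  unfolding nat_span_def by (auto intro!: lincomb_closed)

lemma span_mult:
  assumes S: "S \<subseteq> carrier G" and "a \<in> nat_span S" "b \<in> nat_span S"
  shows "a \<otimes> b \<in> nat_span S"
proof -
  obtain c Y d Z where Y: "finite Y" "Y \<subseteq> S" "a = lincomb c Y"
    and Z: "finite Z" "Z \<subseteq> S" "b = lincomb d Z"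
    using assms by (meson nat_spanE)
  let ?c = "\<lambda>y. if y \<in> Y then c y else 0" and ?d = "\<lambda>y. if y \<in> Z then d y else 0"
  have C: "y \<in> carrier G" if "y \<in> Y \<union> Z" for y using that S Y Z by blast
  have "a = lincomb ?c (Y \<union> Z)" "b = lincomb ?d (Y \<union> Z)"
    unfolding Y Z lincomb_def
    by (rule finprod_mono_neutral_cong_left; use Y Z C in auto)+
  moreover have "lincomb (\<lambda>y. ?c y + ?d y) (Y \<union> Z) = lincomb ?c (Y \<union> Z) \<otimes> lincomb ?d (Y \<union> Z)"
  proof -
    have "lincomb ?c (Y \<union> Z) \<otimes> lincomb ?d (Y \<union> Z) = (\<Otimes>y\<in>Y \<union> Z. y [^] ?c y \<otimes> y [^] ?d y)"
      unfolding lincomb_def by (rule finprod_multf[symmetric]) (use C in \<open>intro Pi_I nat_pow_closed; blast\<close>)+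
    also have "\<dots> = lincomb (\<lambda>y. ?c y + ?d y) (Y \<union> Z)"
      unfolding lincomb_def
      by (rule finprod_cong') (use C in \<open>auto simp only: nat_pow_mult nat_pow_closed Pi_iff\<close>)
    finally show ?thesis ..
  qed
  moreover have "lincomb (\<lambda>y. ?c y + ?d y) (Y \<union> Z) \<in> nat_span S"
    by (rule nat_spanI) (use Y Z in auto)
  ultimately show ?thesis by simp
qed

lemma span_one: "\<one> \<in> nat_span S"
  using nat_spanI[of "{}" S] by (simp add: lincomb_def)

lemma span_nat_pow:
  assumes "S \<subseteq> carrier G" "a \<in> nat_span S"
  shows "a [^] (n::nat) \<in> nat_span S"
  by (induction n) (use span_one span_mult assms in auto)

lemma span_subgroup:
  assumes S: "S \<subseteq> carrier G"
  shows "subgroup (nat_span S) G"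
proof (rule subgroupI)
  show "nat_span S \<subseteq> carrier G" by (rule span_closed[OF S])
  show "nat_span S \<noteq> {}" using span_one by blast
  fix a assume a: "a \<in> nat_span S"
  then have aC: "a \<in> carrier G" using span_closed[OF S] by blast
  obtain k where k: "a [^] (p ^ k) = \<one>" using p_torsion aC by blast
  then have "a [^] (p ^ k - 1) \<otimes> a = \<one>"
    using aC p_pos by (metis Suc_diff_1 nat_pow_Suc zero_less_power)
  then have "inv a = a [^] (p ^ k - 1)" using aC by (simp add: inv_equality)
  then show "inv a \<in> nat_span S" using span_nat_pow[OF S a] by simp
qed (rule span_mult[OF S])

lemma span_superset:
  assumes "S \<subseteq> carrier G" 
  shows "S \<subseteq> nat_span S"
proof
  fix x assume x: "x \<in> S"
  then have "lincomb (\<lambda>_. 1) {x} = x"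
    using assms unfolding lincomb_def by (subst finprod_insert) auto
  moreover have "lincomb (\<lambda>_. 1) {x} \<in> nat_span S"
    by (rule nat_spanI) (use x in auto)
  ultimately show "x \<in> nat_span S" by simp
qed

lemma span_p_pure:
  assumes S: "pure_independent S" and "b \<in> nat_span S" "b = a [^] (p ^ k)" "a \<in> carrier G"
  shows "\<exists>b'\<in>nat_span S. b = b' [^] (p ^ k)"
proof -
  obtain c Y where Y: "finite Y" "Y \<subseteq> S" "b = lincomb c Y"
    using assms(2) by (rule nat_spanE)
  have YC: "Y \<subseteq> carrier G" using Y S unfolding pure_independent_def by blast
  have "\<forall>y\<in>Y. \<exists>d. y [^] c y = y [^] (p ^ k * d)"
    using pure_independentD[OF S Y(1,2)] assms Y by metis
  then obtain d where d: "\<And>y. y \<in> Y \<Longrightarrow> y [^] c y = y [^] (p ^ k * d y)" by metis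
  have "b = lincomb d Y [^] (p ^ k)"
    unfolding Y(3) lincomb_power[OF Y(1) YC] by (rule lincomb_cong[OF d YC])
  then show ?thesis using nat_spanI[OF Y(1,2)] by blast
qed

lemma span_pure:
  assumes S: "pure_independent S"
  shows "pure_subgroup (nat_span S) G"
proof -
  have SC: "S \<subseteq> carrier G" using S unfolding pure_independent_def by blast
  have sub: "subgroup (nat_span S) G" by (rule span_subgroup[OF SC])
  have nat: "\<exists>b'\<in>nat_span S. b = b' [^] n" if b: "b \<in> nat_span S" "b = a [^] n" "a \<in> carrier G" for n :: nat and a b
  proof (cases "n = 0")
    case True
    then show ?thesis using that span_one by (auto intro!: bexI[of _ \<one>])
  next
    case False
    then obtain e m where nm: "n = p ^ e * m" "\<not> p dvd m"
      using prime_p by (metis mult.commute multiplicity_decompose' not_prime_unit)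
    have "b = (a [^] m) [^] (p ^ e)" using b nm by (simp add: nat_pow_pow mult.commute)
    then obtain b' where b': "b' \<in> nat_span S" "b = b' [^] (p ^ e)"
      using span_p_pure[OF S b(1), of "a [^] m" e] b(3) by auto
    have b'C: "b' \<in> carrier G" using b' span_closed[OF SC] by blast
    obtain r where r: "b' [^] (m * r) = b'" using p_torsion[OF b'C] coprime_root[OF b'C] nm(2) by blast
    have "(b' [^] r) [^] n = (b' [^] (m * r)) [^] (p ^ e)"
      using b'C by (simp add: nat_pow_pow nm(1) mult_ac)
    then have "(b' [^] r) [^] n = b" using r b'(2) by simp
    then show ?thesis using span_nat_pow[OF SC b'(1)] by blast
  qed
  have "\<exists>b'\<in>nat_span S. b = b' [^] n" if b: "b \<in> nat_span S" "b = a [^] n" "a \<in> carrier G" for n :: int and a b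
  proof (cases "n \<ge> 0")
    case True
    then have pow: "x [^] n = x [^] nat n" for x
      using int_pow_int[of G x "nat n"] by (simp only: int_nat_eq if_True simp_thms)
    show ?thesis using nat[OF b(1) b(2)[unfolded pow] b(3)] unfolding pow .
  next
    case False
    then obtain m :: nat where n: "n = - int m" by (metis int_cases3 neg_0_le_iff_le neg_le_0_iff_le of_nat_0_le_iff order_refl)
    have neg: "x [^] n = inv x [^] m" if "x \<in> carrier G" for x
      unfolding n int_pow_neg_int[OF that] by (rule nat_pow_inv[OF that, symmetric])
    obtain b' where "b' \<in> nat_span S" "b = b' [^] m"
      using nat[OF b(1) b(2)[unfolded neg[OF b(3)]]] b(3) by auto
    moreover have "b' \<in> carrier G" using calculation span_closed[OF SC] by blast
    moreover from this have "b = inv b' [^] n"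
      using neg[of "inv b'"] calculation by simp
    moreover have "inv b' \<in> nat_span S"
      using subgroup.m_inv_closed[OF sub \<open>b' \<in> nat_span S\<close>] .
    ultimately show ?thesis by blast
  qed
  moreover have "b [^] n \<in> nat_span S" if "b \<in> nat_span S" for b and n :: int
    using that sub by (simp add: subgroup_int_pow_closed)
  ultimately show ?thesis
    unfolding pure_subgroup_def using sub span_closed[OF SC] by (fastforce simp: image_iff)
qed

text \<open>Sending a finitely supported family to the product of its entries is a homomorphism onto the
  span, and independence makes its kernel trivial.\<close>
lemma span_direct_sum_of_cyclic:
  assumes S: "pure_independent S"
  shows "direct_sum_of_cyclic_groups (G\<lparr>carrier := nat_span S\<rparr>)"
proof -
  have SC: "S \<subseteq> carrier G" using S unfolding pure_independent_def by blast
  \<comment> \<open>\<open>M\<close> is \<open>G\<close> with any additional record fields dropped: the summands must be plain monoids.\<close>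
  define M where "M = \<lparr>carrier = carrier G, monoid.mult = monoid.mult G, one = \<one>\<rparr>"
  have M: "carrier M = carrier G" "monoid.mult M = monoid.mult G" "\<one>\<^bsub>M\<^esub> = \<one>"
    by (simp_all add: M_def)
  interpret M: group M
    by (rule groupI) (auto simp: M m_assoc intro: l_inv_ex)
  have Mpow: "x [^]\<^bsub>M\<^esub> (n::nat) = x [^] n" for x n
    by (simp add: nat_pow_def M)
  define C where "C = (\<lambda>x. subgroup_generated M {x})"
  have Cmult: "monoid.mult (C x) = monoid.mult G" "\<one>\<^bsub>C x\<^esub> = \<one>" for x
    by (simp_all add: C_def subgroup_generated_def M)
  have grp: "group (C x)" for x
    unfolding C_def by (rule M.group_subgroup_generated)
  have cyc: "cyclic_group (C x)" for x
    unfolding C_def by (rule M.cyclic_group_generated)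
  have Ccar: "carrier (C x) = range (\<lambda>n::nat. x [^] n)" if x: "x \<in> carrier G" for x
  proof -
    have "carrier (C x) = range (\<lambda>n::int. x [^]\<^bsub>M\<^esub> n)"
      unfolding C_def using x by (intro M.carrier_subgroup_generated_by_singleton) (simp add: M)
    \<comment> \<open>Integer exponents reduce to natural ones modulo a power of \<open>p\<close> that kills \<open>x\<close>.\<close>
    moreover have "x [^]\<^bsub>M\<^esub> n \<in> range (\<lambda>n::nat. x [^] n)" for n :: int
    proof -
      obtain k where k: "x [^] (p ^ k) = \<one>" using p_torsion x by blast
      let ?q = "int (p ^ k)"
      have xM: "x \<in> carrier M" using x by (simp add: M)
      have "x [^]\<^bsub>M\<^esub> ?q = \<one>" using k by (simp only: int_pow_int Mpow)
      then have "x [^]\<^bsub>M\<^esub> (?q * (n div ?q)) = \<one>"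
        using M.int_pow_pow[OF xM, of "?q" "n div ?q"] M.int_pow_one[of "n div ?q"] by (simp add: M)
      then have "x [^]\<^bsub>M\<^esub> n = x [^]\<^bsub>M\<^esub> (n mod ?q)"
        using M.int_pow_mult[OF xM, of "?q * (n div ?q)" "n mod ?q"] M.int_pow_closed[OF xM, of "n mod ?q"]
          by (simp add: M)
      also have "n mod ?q = int (nat (n mod ?q))" using p_pos by simp
      also have "x [^]\<^bsub>M\<^esub> int (nat (n mod ?q)) = x [^] nat (n mod ?q)"
        by (simp only: int_pow_int Mpow)
      finally show ?thesis by blast
    qed
    moreover have "x [^] n = x [^]\<^bsub>M\<^esub> int n" for n :: nat by (simp only: int_pow_int Mpow)
    ultimately show ?thesis by (metis (no_types, lifting) image_subsetI rangeI subset_antisym)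
  qed
  have CG: "carrier (C x) \<subseteq> carrier G" if "x \<in> S" for x
    using Ccar[of x] subsetD[OF SC that] by auto
  let ?D = "sum_group S C" and ?B = "G\<lparr>carrier := nat_span S\<rparr>"
  define supp where "supp f = {i \<in> S. f i \<noteq> \<one>}" for f :: "'a \<Rightarrow> 'a"
  define h where "h f = (\<Otimes>i\<in>supp f. f i)" for f :: "'a \<Rightarrow> 'a"
  have D: "carrier ?D = {f \<in> \<Pi>\<^sub>E i\<in>S. carrier (C i). finite (supp f)}"
    using carrier_sum_group[of S C] grp by (simp add: Cmult supp_def)
  have DG: "f i \<in> carrier G" if "f \<in> carrier ?D" "i \<in> S" for f i
    using that CG unfolding D by (auto simp: PiE_iff)
  have Dpow: "\<exists>c. \<forall>i\<in>S. f i = i [^] (c i :: nat)" if "f \<in> carrier ?D" for f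
  proof -
    have "\<exists>c::nat. f i = i [^] c" if "i \<in> S" for i
    proof -
      have "f i \<in> carrier (C i)" using \<open>f \<in> carrier ?D\<close> that unfolding D by (auto simp: PiE_iff)
      then show ?thesis using Ccar[of i] subsetD[OF SC that] by auto
    qed
    then show ?thesis by metis
  qed
  have h_lincomb: "h f = lincomb c (supp f)" if "f \<in> carrier ?D" "\<forall>i\<in>S. f i = i [^] (c i :: nat)" for f c
    unfolding h_def lincomb_def
    by (rule finprod_cong') (use that SC in \<open>auto simp: supp_def\<close>)
  have h_sup: "h f = (\<Otimes>i\<in>T. f i)" if "f \<in> carrier ?D" "finite T" "supp f \<subseteq> T" "T \<subseteq> S" for f T
    unfolding h_def
    by (rule finprod_mono_neutral_cong_left) (use that DG in \<open>auto simp: supp_def\<close>)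
  interpret D: group ?D by (rule sum_group) (rule grp)
  interpret B: group ?B by (rule subgroup_imp_group[OF span_subgroup[OF SC]])
  have hom: "h \<in> hom ?D ?B"
  proof (rule homI)
    fix f assume f: "f \<in> carrier ?D"
    obtain c where c: "\<forall>i\<in>S. f i = i [^] (c i :: nat)" using Dpow[OF f] by blast
    have "finite (supp f)" "supp f \<subseteq> S" using f unfolding D by (auto simp: supp_def)
    then show "h f \<in> carrier ?B"
      using nat_spanI[of "supp f" S c] h_lincomb[OF f c] by simp
  next
    fix f g assume f: "f \<in> carrier ?D" and g: "g \<in> carrier ?D"
    let ?T = "supp f \<union> supp g"
    have fin: "finite ?T" and sub: "?T \<subseteq> S" using f g unfolding D by (auto simp: supp_def)
    have fg: "f \<otimes>\<^bsub>?D\<^esub> g \<in> carrier ?D" by (rule D.m_closed[OF f g])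
    have "supp (f \<otimes>\<^bsub>?D\<^esub> g) \<subseteq> ?T" by (auto simp: supp_def Cmult)
    from h_sup[OF fg fin this sub]
    have "h (f \<otimes>\<^bsub>?D\<^esub> g) = (\<Otimes>i\<in>?T. (f \<otimes>\<^bsub>?D\<^esub> g) i)" .
    also have "\<dots> = (\<Otimes>i\<in>?T. f i \<otimes> g i)"
      by (rule finprod_cong') (use sub DG[OF f] DG[OF g] in \<open>auto simp: Cmult\<close>)
    also have "\<dots> = (\<Otimes>i\<in>?T. f i) \<otimes> (\<Otimes>i\<in>?T. g i)"
      by (rule finprod_multf) (use sub DG[OF f] DG[OF g] in auto)
    also have "\<dots> = h f \<otimes> h g"
      using h_sup[OF f fin _ sub] h_sup[OF g fin _ sub] by simp
    finally show "h (f \<otimes>\<^bsub>?D\<^esub> g) = h f \<otimes>\<^bsub>?B\<^esub> h g" by simp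
  qed
  interpret h: group_hom ?D ?B h
    by unfold_locales (rule hom)
  have "inj_on h (carrier ?D)"
  proof (subst h.inj_on_one_iff, intro allI impI)
    fix f assume f: "f \<in> carrier ?D" and "h f = \<one>\<^bsub>?B\<^esub>"
    then have one: "h f = \<one>" by simp
    obtain c where c: "\<forall>i\<in>S. f i = i [^] (c i :: nat)" using Dpow[OF f] by blast
    \<comment> \<open>\<open>\<one>\<close> is a \<open>p\<^sup>k\<close>-th power for every \<open>k\<close>, in particular for one with \<open>i\<^bsup>p^k\<^esup> = \<one>\<close>.\<close>
    have "f i = \<one>" if i: "i \<in> S" for i
    proof (rule ccontr)
      assume "f i \<noteq> \<one>"
      then have i': "i \<in> supp f" using i by (simp add: supp_def)
      obtain k where k: "i [^] (p ^ k) = \<one>" using p_torsion i SC by blast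
      have "lincomb c (supp f) = \<one> [^] (p ^ k)" using h_lincomb[OF f c, symmetric] one by simp
      then obtain d where "i [^] c i = i [^] (p ^ k * d)"
        using pure_independentD[OF S, of "supp f" \<one> c k] i' f unfolding D by (auto simp: supp_def)
      then have "i [^] c i = \<one>"
        using k nat_pow_pow[of i "p ^ k" d] i SC by (auto simp: nat_pow_one)
      then show False using \<open>f i \<noteq> \<one>\<close> c i by simp
    qed
    then show "f = \<one>\<^bsub>?D\<^esub>"
      using f unfolding D by (auto simp: Cmult PiE_iff extensional_def fun_eq_iff)
  qed
  moreover have "h ` carrier ?D = carrier ?B"
  proof
    show "h ` carrier ?D \<subseteq> carrier ?B" using hom by (auto simp: hom_def)
    show "carrier ?B \<subseteq> h ` carrier ?D"
    proof
      fix b assume "b \<in> carrier ?B"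
      then obtain c Y where Y: "finite Y" "Y \<subseteq> S" "b = lincomb c Y" by (auto elim: nat_spanE)
      define f where "f = (\<lambda>i\<in>S. if i \<in> Y then i [^] c i else \<one>)"
      have pw: "\<exists>n::nat. f i = i [^] n" if "i \<in> S" for i
        unfolding f_def using that by (auto intro: exI[of _ "0::nat"])
      have fC: "f i \<in> carrier (C i)" if "i \<in> S" for i
        using pw[OF that] Ccar[OF subsetD[OF SC that]] by (metis rangeI)
      have sub: "supp f \<subseteq> Y" by (auto simp: supp_def f_def)
      have "f \<in> carrier ?D"
        unfolding D using fC finite_subset[OF sub Y(1)] by (simp add: PiE_iff) (simp add: f_def)
      moreover from h_sup[OF this Y(1) sub Y(2)] have "h f = (\<Otimes>i\<in>Y. f i)" .
      moreover have "(\<Otimes>i\<in>Y. f i) = b"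
        unfolding Y(3) lincomb_def
        by (rule finprod_cong') (use Y SC in \<open>auto simp: f_def\<close>)
      ultimately show "b \<in> h ` carrier ?D" by (metis imageI)
    qed
  qed
  ultimately have "h \<in> iso ?D ?B"
    using hom by (simp add: iso_def bij_betw_def)
  then have "?D \<cong> ?B" unfolding is_iso_def by blast
  then show ?thesis
    unfolding direct_sum_of_cyclic_groups_def using grp cyc by blast
qed

text \<open>If the quotient by the span \<open>B\<close> is not divisible, its socle contains an element of finite height,
  and purity of \<open>B\<close> allows this element to be lifted to \<open>x\<^bsup>p^h\<^esup>\<close> with \<open>x\<close> of order \<open>p\<^bsup>h+1\<^esup>\<close> in the
  group itself.  The argument is the contrapositive: if there is no such \<open>x\<close>, then subtracting a
  suitable \<open>p\<close>-fold multiple and an element of \<open>B\<close> from \<open>a\<close> lowers the order of \<open>a\<close>, and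
  induction on the order makes \<open>a\<close> divisible by \<open>p\<close> modulo \<open>B\<close>.\<close>
lemma finite_height_mod_pure_span:
  assumes S: "pure_independent S"
    and a: "a \<in> carrier G" "\<And>y b. y \<in> carrier G \<Longrightarrow> b \<in> nat_span S \<Longrightarrow> a \<noteq> y [^] p \<otimes> b"
  obtains x h where "x \<in> carrier G" "x [^] (p ^ Suc h) = \<one>"
    "\<And>y b. y \<in> carrier G \<Longrightarrow> b \<in> nat_span S \<Longrightarrow> x [^] (p ^ h) \<noteq> y [^] (p ^ Suc h) \<otimes> b"
proof (rule ccontr)
  note witness = that
  assume "\<not> thesis"
  then have inf: "\<exists>y\<in>carrier G. \<exists>b\<in>nat_span S. x [^] (p ^ h) = y [^] (p ^ Suc h) \<otimes> b"
    if "x \<in> carrier G" "x [^] (p ^ Suc h) = \<one>" for x h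
    using that \<open>\<not> thesis\<close> witness[of x h] by blast
  have SC: "S \<subseteq> carrier G" using S unfolding pure_independent_def by blast
  note BC = subsetD[OF span_closed[OF SC]]
  have "\<exists>y\<in>carrier G. \<exists>b\<in>nat_span S. a = y [^] p \<otimes> b"
    if "a \<in> carrier G" "a [^] (p ^ k) = \<one>" for a k
    using that
  proof (induction k arbitrary: a)
    case 0
    then show ?case using span_one[of S] by (auto intro!: bexI[of _ \<one>])
  next
    case (Suc k)
    obtain y b where y: "y \<in> carrier G" "b \<in> nat_span S" "a [^] (p ^ k) = y [^] (p ^ Suc k) \<otimes> b"
      using inf[OF Suc.prems] by blast
    have bC: "b \<in> carrier G" using BC y by blast
    have "b = (a \<otimes> inv (y [^] p)) [^] (p ^ k)"
    proof -
      have "(a \<otimes> inv (y [^] p)) [^] (p ^ k) = a [^] (p ^ k) \<otimes> inv (y [^] (p ^ Suc k))"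
        using y(1) Suc.prems(1) by (simp add: nat_pow_distrib nat_pow_inv nat_pow_pow mult.commute)
      also have "\<dots> = b"
        unfolding y(3) using y(1) bC by (simp add: m_comm[of _ b] m_assoc)
      finally show ?thesis by simp
    qed
    then obtain b' where b': "b' \<in> nat_span S" "b = b' [^] (p ^ k)"
      using span_p_pure[OF S y(2), of "a \<otimes> inv (y [^] p)" k] y(1) Suc.prems(1) by auto
    have b'C: "b' \<in> carrier G" using BC b' by blast
    let ?a = "a \<otimes> inv (y [^] p \<otimes> b')"
    have "?a [^] (p ^ k) = a [^] (p ^ k) \<otimes> inv ((y [^] p) [^] (p ^ k) \<otimes> b' [^] (p ^ k))"
      using y(1) b'C Suc.prems(1) by (simp add: nat_pow_distrib nat_pow_inv)
    also have "(y [^] p) [^] (p ^ k) \<otimes> b' [^] (p ^ k) = a [^] (p ^ k)"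
      using y b' by (simp add: nat_pow_pow)
    finally have "?a [^] (p ^ k) = \<one>" using Suc.prems(1) by simp
    then obtain z c where z: "z \<in> carrier G" "c \<in> nat_span S" "?a = z [^] p \<otimes> c"
      using Suc.IH[of ?a] y(1) b'C Suc.prems(1) by auto
    have cC: "c \<in> carrier G" using BC z by blast
    have "a = ?a \<otimes> (y [^] p \<otimes> b')"
      using y(1) b'C Suc.prems(1) by (simp add: m_assoc)
    also have "\<dots> = (z \<otimes> y) [^] p \<otimes> (c \<otimes> b')"
      unfolding z(3) using z(1) cC y(1) b'C by (simp add: nat_pow_distrib m_ac)
    finally show ?case using z(1) y(1) span_mult[OF SC z(2) b'(1)] by blast
  qed
  then show False using a p_torsion by metis
qed

text \<open>Consider a combination involving \<open>c x\<close> that is divisible by \<open>p\<^sup>k\<close>.  If \<open>c x\<close> is divisible by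
  \<open>p\<^sup>k\<close> within the cyclic group of \<open>x\<close>, it can be moved to the other side and the rest lies in the
  old span.  Otherwise \<open>c = p\<^sup>i m\<close> with \<open>i < k\<close>, \<open>i \<le> h\<close> and \<open>m\<close> prime to \<open>p\<close>, and multiplying by
  \<open>p\<^bsup>h-i\<^esup>\<close> shows that \<open>p\<^sup>h x\<close> is divisible by \<open>p\<^bsup>h+1\<^esup>\<close> modulo the old span, against the choice of
  \<open>x\<close>.\<close>
lemma pure_independent_insert:
  assumes S: "pure_independent S" and x: "x \<in> carrier G" "x [^] (p ^ Suc h) = \<one>"
    and ht: "\<And>y b. y \<in> carrier G \<Longrightarrow> b \<in> nat_span S \<Longrightarrow> x [^] (p ^ h) \<noteq> y [^] (p ^ Suc h) \<otimes> b"
  shows "pure_independent (insert x S)"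
proof -
  have SC: "S \<subseteq> carrier G" using S unfolding pure_independent_def by blast
  note BC = subsetD[OF span_closed[OF SC]]
  have main: "\<exists>d. y [^] c y = y [^] (p ^ k * d)"
    if Y: "finite Y" "Y \<subseteq> insert x S" and a: "a \<in> carrier G" and eq: "lincomb c Y = a [^] (p ^ k)"
      and y: "y \<in> Y" for Y c k a y
  proof (cases "x \<in> Y")
    case False
    then show ?thesis using pure_independentD[OF S Y(1) _ a eq y] Y(2) by blast
  next
    case True
    let ?Z = "Y - {x}" and ?b = "lincomb c (Y - {x})"
    have Z: "finite ?Z" "?Z \<subseteq> S" using Y by auto
    have bS: "?b \<in> nat_span S" by (rule nat_spanI[OF Z])
    then have bC: "?b \<in> carrier G" by (rule BC)
    have eq': "x [^] c x \<otimes> ?b = a [^] (p ^ k)"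
      using lincomb_insert[of ?Z x c] Z SC x(1) eq True by (simp add: insert_absorb subset_trans)
    have x_div: "\<exists>d. x [^] c x = x [^] (p ^ k * d)"
    proof (cases "p ^ k dvd c x")
      case True
      then show ?thesis by (metis dvdE)
    next
      case False
      then have "c x \<noteq> 0" by (metis dvd_0_right)
      then obtain i m where cx: "c x = p ^ i * m" "\<not> p dvd m"
        using prime_p by (metis mult.commute multiplicity_decompose' not_prime_unit)
      have ik: "i < k"
        using False cx by (metis dvd_triv_left le_imp_power_dvd dvd_mult2 not_less)
      show ?thesis
      proof (cases "i \<le> h")
        case False
        then obtain j where "i = Suc h + j" by (metis add.commute less_iff_Suc_add not_less add_Suc_right)
        then have "c x = p ^ Suc h * (p ^ j * m)" using cx(1) by (simp add: power_add mult_ac)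
        then have "x [^] c x = \<one>"
          using x nat_pow_pow[OF x(1), of "p ^ Suc h" "p ^ j * m"] by simp
        then have "x [^] c x = x [^] (p ^ k * 0)" by simp
        then show ?thesis by blast
      next
        case True
        obtain r where r: "(x [^] (p ^ h)) [^] (m * r) = x [^] (p ^ h)"
          using coprime_root[of "x [^] (p ^ h)" 1 m] cx(2) x by (auto simp: nat_pow_pow mult.commute)
        \<comment> \<open>\<open>p\<^bsup>h-i\<^esup>\<close> raises \<open>p\<^sup>i m\<close> to \<open>p\<^sup>h m\<close>, and \<open>r\<close> then cancels \<open>m\<close>.\<close>
        let ?e = "p ^ (h - i) * r"
        have "x [^] (p ^ h) = (x [^] c x) [^] ?e"
        proof -
          have "p ^ h * (m * r) = c x * ?e"
            unfolding cx(1) using True by (simp add: mult_ac flip: power_add)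
          then show ?thesis using r x(1) by (simp only: nat_pow_pow nat_pow_closed)
        qed
        also have "x [^] c x = a [^] (p ^ k) \<otimes> inv ?b"
          using eq' x(1) a bC by (metis inv_solve_right' m_closed nat_pow_closed)
        also have "\<dots> [^] ?e = (a [^] (p ^ k)) [^] ?e \<otimes> inv ?b [^] ?e"
          using a bC by (simp add: nat_pow_distrib)
        also have "(a [^] (p ^ k)) [^] ?e = (a [^] (p ^ (k - Suc i) * r)) [^] (p ^ Suc h)"
        proof -
          have "p ^ k * ?e = p ^ (k - Suc i) * r * p ^ Suc h"
          proof -
            have "k + (h - i) = (k - Suc i) + Suc h" using True ik by simp
            then have "p ^ k * p ^ (h - i) = p ^ (k - Suc i) * p ^ Suc h"
              by (simp only: power_add[symmetric])
            then show ?thesis by (simp add: mult_ac)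
          qed
          then show ?thesis using a by (simp only: nat_pow_pow)
        qed
        finally have "x [^] (p ^ h) = (a [^] (p ^ (k - Suc i) * r)) [^] (p ^ Suc h) \<otimes> inv ?b [^] ?e" .
        moreover have "inv ?b [^] ?e \<in> nat_span S"
          by (rule span_nat_pow[OF SC subgroup.m_inv_closed[OF span_subgroup[OF SC] bS]])
        ultimately show ?thesis using ht a by (metis nat_pow_closed)
      qed
    qed
    then obtain d where d: "x [^] c x = x [^] (p ^ k * d)" by blast
    show ?thesis
    proof (cases "y = x")
      case True
      then show ?thesis using d by blast
    next
      case False
      have "?b = a [^] (p ^ k) \<otimes> inv (x [^] (p ^ k * d))"
        using eq' x(1) a bC unfolding d by (metis inv_solve_right' m_closed m_comm nat_pow_closed)
      also have "\<dots> = (a \<otimes> inv (x [^] d)) [^] (p ^ k)"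
        using x(1) a by (simp add: nat_pow_distrib nat_pow_inv nat_pow_pow mult.commute)
      finally show ?thesis
        using pure_independentD[OF S Z, of "a \<otimes> inv (x [^] d)" c k y] a x(1) y False by auto
    qed
  qed
  then show ?thesis
    unfolding pure_independent_def using SC x(1) by blast
qed

lemma maximal_pure_independent:
  obtains S where "pure_independent S" "\<And>T. pure_independent T \<Longrightarrow> S \<subseteq> T \<Longrightarrow> T = S"
proof -
  have "\<exists>M\<in>{S. pure_independent S}. \<forall>T\<in>{S. pure_independent S}. M \<subseteq> T \<longrightarrow> T = M"
  proof (rule subset_Zorn_nonempty)
    have "pure_independent {}" unfolding pure_independent_def by auto
    then show "{S. pure_independent S} \<noteq> {}" by blast
  next
    fix \<C> assume C: "\<C> \<noteq> {}" "subset.chain {S. pure_independent S} \<C>"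
    then have PI: "\<And>S. S \<in> \<C> \<Longrightarrow> pure_independent S" by (auto simp: subset_chain_def)
    have "\<exists>d. y [^] c y = y [^] (p ^ k * d)"
      if Y: "finite Y" "Y \<subseteq> \<Union>\<C>" and a: "a \<in> carrier G" "lincomb c Y = a [^] (p ^ k)" "y \<in> Y" for Y c k a y
    proof -
      obtain S where "S \<in> \<C>" "Y \<subseteq> S" using finite_subset_Union_chain[OF Y C] by blast
      then show ?thesis using pure_independentD[OF PI Y(1) _ a] by blast
    qed
    moreover have "\<Union>\<C> \<subseteq> carrier G" using PI unfolding pure_independent_def by blast
    ultimately show "\<Union>\<C> \<in> {S. pure_independent S}" unfolding pure_independent_def by blast
  qed
  then show ?thesis using that by blast
qed

text \<open>Kulikov's theorem: the span of a maximal pure independent set is basic.  The decomposition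
  \<open>A = p A + B\<close> is recorded separately because it is what the coding of endomorphisms
  consumes.\<close>
lemma ex_basic_subgroup:
  obtains B where "basic_subgroup B G"
    "\<And>a. a \<in> carrier G \<Longrightarrow> \<exists>y\<in>carrier G. \<exists>b\<in>B. a = y [^] p \<otimes> b"
proof -
  obtain S where S: "pure_independent S" and max: "\<And>T. pure_independent T \<Longrightarrow> S \<subseteq> T \<Longrightarrow> T = S"
    using maximal_pure_independent by blast
  have SC: "S \<subseteq> carrier G" using S unfolding pure_independent_def by blast
  let ?B = "nat_span S"
  have decomp: "\<exists>y\<in>carrier G. \<exists>b\<in>?B. a = y [^] p \<otimes> b" if a: "a \<in> carrier G" for a
  proof (rule ccontr)
    assume "\<not> ?thesis"
    then obtain x h where x: "x \<in> carrier G" "x [^] (p ^ Suc h) = \<one>"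
      "\<And>y b. y \<in> carrier G \<Longrightarrow> b \<in> ?B \<Longrightarrow> x [^] (p ^ h) \<noteq> y [^] (p ^ Suc h) \<otimes> b"
      using finite_height_mod_pure_span[OF S a] by blast
    have "x \<in> S" using max[OF pure_independent_insert[OF S x]] by blast
    then have "x [^] (p ^ h) \<in> ?B" using span_superset[OF SC] span_nat_pow[OF SC] by blast
    then show False using x(3)[of \<one> "x [^] (p ^ h)"] x(1) by simp
  qed
  have sub: "subgroup ?B G" by (rule span_subgroup[OF SC])
  interpret B: normal ?B G
    by (rule normal_iff_subgroup[THEN iffD2, OF sub])
  interpret Q: comm_group "G Mod ?B" by (rule abelian_FactGroup[OF sub])
  have Qcar: "\<exists>a\<in>carrier G. q = ?B #> a" if "q \<in> carrier (G Mod ?B)" for q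
    using that by (auto simp: carrier_FactGroup)
  interpret Q: abelian_p_group "G Mod ?B" p
  proof unfold_locales
    fix q assume "q \<in> carrier (G Mod ?B)"
    then obtain a where a: "a \<in> carrier G" "q = ?B #> a" using Qcar by blast
    obtain k where "a [^] (p ^ k) = \<one>" using p_torsion a by blast
    then have "q [^]\<^bsub>G Mod ?B\<^esub> (p ^ k) = \<one>\<^bsub>G Mod ?B\<^esub>"
      unfolding a(2) B.FactGroup_pow[OF a(1)] by (simp add: coset_mult_one B.subset)
    then show "\<exists>k. q [^]\<^bsub>G Mod ?B\<^esub> (p ^ k) = \<one>\<^bsub>G Mod ?B\<^esub>" by blast
  qed (rule prime_p)
  have "divisible_group (G Mod ?B)"
  proof (rule Q.divisible_if_p_divisible)
    fix q assume "q \<in> carrier (G Mod ?B)"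
    then obtain a where a: "a \<in> carrier G" "q = ?B #> a" using Qcar by blast
    obtain y b where y: "y \<in> carrier G" "b \<in> ?B" "a = y [^] p \<otimes> b" using decomp[OF a(1)] by blast
    have bC: "b \<in> carrier G" using y(2) B.subset by blast
    have "?B #> y [^] p = (?B #> b) #> y [^] p" using coset_join2[OF bC sub y(2)] by simp
    also have "\<dots> = q"
      unfolding a(2) y(3) using y(1) bC B.subset by (simp add: coset_mult_assoc m_comm)
    finally have "(?B #> y) [^]\<^bsub>G Mod ?B\<^esub> p = q" using B.FactGroup_pow[OF y(1)] by simp
    then show "\<exists>y\<in>carrier (G Mod ?B). y [^]\<^bsub>G Mod ?B\<^esub> p = q"
      using y(1) by (auto simp: carrier_FactGroup)
  qed
  then have "basic_subgroup ?B G"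
    unfolding basic_subgroup_def
    using sub span_direct_sum_of_cyclic[OF S] span_pure[OF S] by blast
  then show ?thesis using that decomp by blast
qed

end

section \<open>Countable codes of endomorphisms\<close>

context abelian_p_group
begin

text \<open>The relation coded by \<open>P\<close>: \<open>(a, b)\<close> lies in the largest relation all of whose members
  \<open>(x, y)\<close> split as a \<open>p\<close>-fold multiple of another member plus a pair from \<open>P\<close>.  If \<open>P\<close> lists
  the pairs \<open>(u, F u)\<close> for \<open>u\<close> in \<open>B\<close>, this evaluates \<open>F\<close> along an expansion
  \<open>a = u\<^sub>0 + p u\<^sub>1 + p\<^sup>2 u\<^sub>2 + \<dots>\<close> with the \<open>u\<^sub>i\<close> in \<open>B\<close>.  One expansion involves only countably
  many pairs, so \<open>g\<close> may be required to be countable, which makes the condition a second order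
  formula with predicates bounded by \<open>\<omega>\<close>.  Pairs are lists because predicate variables are
  interpreted by sets of lists.\<close>
definition codes :: "'a list set \<Rightarrow> 'a \<Rightarrow> 'a \<Rightarrow> bool" where
  "codes P a b \<longleftrightarrow>
     (\<exists>g. g \<subseteq> {as. length as = 2 \<and> set as \<subseteq> carrier G} \<and> |g| \<le>o natLeq \<and> [a, b] \<in> g \<and>
        (\<forall>x\<in>carrier G. \<forall>y\<in>carrier G. [x, y] \<in> g \<longrightarrow>
           (\<exists>x'\<in>carrier G. \<exists>y'\<in>carrier G. [x', y'] \<in> g \<and>
              (\<exists>u\<in>carrier G. \<exists>w\<in>carrier G. [u, w] \<in> P \<and>
                 x = x' [^] p \<otimes> u \<and> y = y' [^] p \<otimes> w))))"

definition restriction_code :: "'a set \<Rightarrow> ('a \<Rightarrow> 'a) \<Rightarrow> 'a list set" where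
  "restriction_code B F = (\<lambda>b. [b, F b]) ` B"

text \<open>The differences \<open>y - F x\<close> over the members \<open>(x, y)\<close> of a witness \<open>g\<close> form a \<open>p\<close>-divisible set:
  passing to the next member divides by \<open>p\<close>, as the pair from the code contributes nothing.  In a
  reduced group all of them vanish.\<close>
lemma codes_imp_value:
  assumes red: "reduced_group G" and F: "F \<in> hom G G" and ab: "a \<in> carrier G" "b \<in> carrier G"
    and code: "codes (restriction_code B F) a b"
  shows "F a = b"
proof -
  interpret F: group_hom G G F by unfold_locales (rule F)
  obtain g where g: "[a, b] \<in> g"
    and step: "\<forall>x\<in>carrier G. \<forall>y\<in>carrier G. [x, y] \<in> g \<longrightarrow>
       (\<exists>x'\<in>carrier G. \<exists>y'\<in>carrier G. [x', y'] \<in> g \<and>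
          (\<exists>u\<in>carrier G. \<exists>w\<in>carrier G. [u, w] \<in> restriction_code B F \<and>
             x = x' [^] p \<otimes> u \<and> y = y' [^] p \<otimes> w))"
    using code unfolding codes_def by (elim exE conjE) (rule that)
  define H where "H = {y \<otimes> inv (F x) | x y. x \<in> carrier G \<and> y \<in> carrier G \<and> [x, y] \<in> g}"
  have "H \<subseteq> {\<one>}"
  proof (rule p_divisible_subset_trivial[OF red])
    show "H \<subseteq> carrier G" unfolding H_def by auto
    fix z assume "z \<in> H"
    then obtain x y where xy: "x \<in> carrier G" "y \<in> carrier G" "[x, y] \<in> g" "z = y \<otimes> inv (F x)"
      unfolding H_def by blast
    obtain x' y' u where s: "x' \<in> carrier G" "y' \<in> carrier G" "[x', y'] \<in> g" "u \<in> carrier G"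
      "x = x' [^] p \<otimes> u" "y = y' [^] p \<otimes> F u"
      using step[rule_format, OF xy(1-3)] unfolding restriction_code_def by auto
    have "(y' \<otimes> inv (F x')) [^] p = z"
      using s(1,2,4) unfolding xy(4) s(5,6)
      by (simp add: nat_pow_distrib nat_pow_inv F.hom_nat_pow inv_mult m_ac)
        (simp flip: m_assoc)
    then show "\<exists>y\<in>H. y [^] p = z" using s unfolding H_def by blast
  qed
  then have "b \<otimes> inv (F a) = \<one>" using ab g unfolding H_def by blast
  then show ?thesis using ab by (metis F.hom_closed inv_solve_right l_one one_closed)
qed

text \<open>The witness is the graph of \<open>F\<close> along the successive remainders \<open>s n\<close> of an expansion of \<open>a\<close>.\<close>
lemma codes_value:
  assumes F: "F \<in> hom G G" and B: "B \<subseteq> carrier G"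
    and decomp: "\<And>a. a \<in> carrier G \<Longrightarrow> \<exists>y\<in>carrier G. \<exists>b\<in>B. a = y [^] p \<otimes> b"
    and a: "a \<in> carrier G"
  shows "codes (restriction_code B F) a (F a)"
proof -
  interpret F: group_hom G G F by unfold_locales (rule F)
  obtain q r where qr: "\<And>x. x \<in> carrier G \<Longrightarrow> q x \<in> carrier G \<and> r x \<in> B \<and> x = q x [^] p \<otimes> r x"
    using decomp by metis
  define s where "s n = (q ^^ n) a" for n
  have sC: "s n \<in> carrier G" for n
    by (induction n) (use a qr in \<open>auto simp: s_def\<close>)
  define g where "g = range (\<lambda>n. [s n, F (s n)])"
  have countable: "|g| \<le>o natLeq"
    unfolding g_def using card_of_image card_of_nat ordLeq_ordIso_trans by blast
  have start: "[a, F a] \<in> g"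
    unfolding g_def by (rule image_eqI[of _ _ 0]) (auto simp: s_def)
  have step: "\<exists>x'\<in>carrier G. \<exists>y'\<in>carrier G. [x', y'] \<in> g \<and>
      (\<exists>u\<in>carrier G. \<exists>w\<in>carrier G. [u, w] \<in> restriction_code B F \<and>
         x = x' [^] p \<otimes> u \<and> y = y' [^] p \<otimes> w)" if "[x, y] \<in> g" for x y
  proof -
    obtain n where n: "x = s n" "y = F (s n)" using \<open>[x, y] \<in> g\<close> unfolding g_def by auto
    have eq: "s n = s (Suc n) [^] p \<otimes> r (s n)" and r: "r (s n) \<in> B"
      using qr[OF sC[of n]] by (auto simp: s_def)
    have rC: "r (s n) \<in> carrier G" using r B by blast
    have "F (s n) = F (s (Suc n) [^] p \<otimes> r (s n))" using eq by simp
    then have Feq: "F (s n) = F (s (Suc n)) [^] p \<otimes> F (r (s n))"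
      using sC rC by (simp add: F.hom_nat_pow)
    have code: "[r (s n), F (r (s n))] \<in> restriction_code B F"
      unfolding restriction_code_def using r by blast
    have next_in_g: "[s (Suc n), F (s (Suc n))] \<in> g" unfolding g_def by blast
    show ?thesis
      unfolding n
      by (rule bexI[of _ "s (Suc n)"], rule bexI[of _ "F (s (Suc n))"], rule conjI[OF next_in_g],
          rule bexI[of _ "r (s n)"], rule bexI[of _ "F (r (s n))"], rule conjI[OF code],
          rule conjI[OF eq Feq]) (use sC rC in simp_all)
  qed
  have pairs: "g \<subseteq> {as. length as = 2 \<and> set as \<subseteq> carrier G}"
    unfolding g_def using sC by auto
  show ?thesis
    unfolding codes_def
    by (rule exI[of _ g], intro conjI ballI impI, (fact pairs countable start)+) (rule step)
qed

end

section \<open>Translating ring formulas into second order formulas\<close>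

definition so_all :: "nat \<Rightarrow> so_form \<Rightarrow> so_form" where
  "so_all x \<phi> = SO_Neg (SO_Ex x (SO_Neg \<phi>))"

definition so_imp :: "so_form \<Rightarrow> so_form \<Rightarrow> so_form" where
  "so_imp \<phi> \<psi> = SO_Neg (SO_Conj \<phi> (SO_Neg \<psi>))"

lemma so_all_simps [simp]:
  "so_sat \<kappa> A (so_all x \<phi>) v P = (\<forall>a\<in>carrier A. so_sat \<kappa> A \<phi> (v(x := a)) P)"
  "so_wf (so_all x \<phi>) = so_wf \<phi>"
  "so_free_obj (so_all x \<phi>) = so_free_obj \<phi> - {x}"
  "so_free_pred (so_all x \<phi>) = so_free_pred \<phi>"
  by (simp_all add: so_all_def)

lemma so_imp_simps [simp]:
  "so_sat \<kappa> A (so_imp \<phi> \<psi>) v P = (so_sat \<kappa> A \<phi> v P \<longrightarrow> so_sat \<kappa> A \<psi> v P)"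
  "so_wf (so_imp \<phi> \<psi>) = (so_wf \<phi> \<and> so_wf \<psi>)"
  "so_free_obj (so_imp \<phi> \<psi>) = so_free_obj \<phi> \<union> so_free_obj \<psi>"
  "so_free_pred (so_imp \<phi> \<psi>) = so_free_pred \<phi> \<union> so_free_pred \<psi>"
  by (simp_all add: so_imp_def)

text \<open>Expresses \<open>x\<^sub>i = n x\<^sub>j + x\<^sub>k\<close>; the variables from \<open>m\<close> on hold the partial sums.\<close>
primrec so_mul_add :: "nat \<Rightarrow> nat \<Rightarrow> nat \<Rightarrow> nat \<Rightarrow> nat \<Rightarrow> so_form" where
  "so_mul_add 0 i j k m = SO_Eq i k"
| "so_mul_add (Suc n) i j k m = SO_Ex m (SO_Conj (SO_Add i j m) (so_mul_add n m j k (Suc m)))"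

text \<open>Binary predicate variable \<open>0\<close> is reserved for the witness of an expansion, and the ring variable
  \<open>x\<close> becomes binary predicate variable \<open>Suc x\<close>.  The last argument of this and the following
  formula is the first object variable free for internal use.\<close>
definition so_codes :: "nat \<Rightarrow> nat \<Rightarrow> nat \<Rightarrow> nat \<Rightarrow> nat \<Rightarrow> so_form" where
  "so_codes p k i j n =
     SO_ExPred 2 0 (SO_Conj (SO_Pred 2 0 [i, j])
       (so_all n (so_all (n+1) (so_imp (SO_Pred 2 0 [n, n+1])
         (SO_Ex (n+2) (SO_Ex (n+3) (SO_Conj (SO_Pred 2 0 [n+2, n+3])
           (SO_Ex (n+4) (SO_Ex (n+5) (SO_Conj (SO_Pred 2 k [n+4, n+5])
             (SO_Conj (so_mul_add p n (n+2) (n+4) (n+6))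
                      (so_mul_add p (n+1) (n+3) (n+5) (n+6)))))))))))))"

text \<open>Terms are evaluated at group elements, so compound terms need no code of their own and no
  predicate variables beyond those of the ring variables.\<close>
primrec so_value :: "nat \<Rightarrow> ring_trm \<Rightarrow> nat \<Rightarrow> nat \<Rightarrow> nat \<Rightarrow> so_form" where
  "so_value p (R_Var x) i j n = so_codes p (Suc x) i j n"
| "so_value p (R_Add s t) i j n =
     SO_Ex n (SO_Ex (n+1) (SO_Conj (SO_Conj (so_value p s i n (n+2)) (so_value p t i (n+1) (n+2)))
       (SO_Add j n (n+1))))"
| "so_value p (R_Mult s t) i j n =
     SO_Ex n (SO_Conj (so_value p t i n (n+1)) (so_value p s n j (n+1)))"

text \<open>Quantification over endomorphisms must be relativised to those countable relations whose coded
  relation is the graph of an endomorphism, as an arbitrary one need not even code a function.\<close>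
definition so_endo :: "nat \<Rightarrow> nat \<Rightarrow> so_form" where
  "so_endo p k =
     SO_Conj (so_all 0 (SO_Ex 1 (so_codes p k 0 1 2)))
    (SO_Conj (so_all 0 (so_all 1 (so_all 2
       (so_imp (so_codes p k 0 1 3) (so_imp (so_codes p k 0 2 3) (SO_Eq 1 2))))))
     (so_all 0 (so_all 1 (so_all 2 (so_all 3
       (so_imp (so_codes p k 0 1 4) (so_imp (so_codes p k 2 3 4)
         (so_all 4 (so_all 5 (so_imp (SO_Add 4 0 2) (so_imp (SO_Add 5 1 3)
            (so_codes p k 4 5 6))))))))))))"

primrec so_of_ring :: "nat \<Rightarrow> ring_form \<Rightarrow> so_form" where
  "so_of_ring p (R_Eq s t) = so_all 0 (SO_Ex 1 (SO_Conj (so_value p s 0 1 2) (so_value p t 0 1 2)))"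
| "so_of_ring p (R_Neg \<phi>) = SO_Neg (so_of_ring p \<phi>)"
| "so_of_ring p (R_Conj \<phi> \<psi>) = SO_Conj (so_of_ring p \<phi>) (so_of_ring p \<psi>)"
| "so_of_ring p (R_Ex x \<phi>) = SO_ExPred 2 (Suc x) (SO_Conj (so_endo p (Suc x)) (so_of_ring p \<phi>))"

lemma so_mul_add_syntax [simp]:
  "so_wf (so_mul_add n i j k m)" "so_free_pred (so_mul_add n i j k m) = {}"
  by (induction n arbitrary: i m) auto

lemma so_free_obj_mul_add: "so_free_obj (so_mul_add n i j k m) \<subseteq> {i, j, k}"
proof (induction n arbitrary: i m)
  case (Suc n)
  show ?case using Suc[of m "Suc m"] by auto
qed auto

lemma so_codes_syntax [simp]:
  "so_wf (so_codes p k i j n)" "so_free_pred (so_codes p k i j n) \<subseteq> {(2, k)}"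
  by (auto simp: so_codes_def)

lemma so_free_obj_codes: "so_free_obj (so_codes p k i j n) \<subseteq> {i, j}"
  using so_free_obj_mul_add[of p n "n+2" "n+4" "n+6"] so_free_obj_mul_add[of p "n+1" "n+3" "n+5" "n+6"]
  by (auto simp: so_codes_def)

lemma so_value_syntax:
  "so_wf (so_value p t i j n)"
  "so_free_obj (so_value p t i j n) \<subseteq> {i, j}"
  "so_free_pred (so_value p t i j n) \<subseteq> (\<lambda>x. (2, Suc x)) ` ring_trm_vars t"
proof (induction t arbitrary: i j n)
  case (R_Var x)
  {
    case 1 show ?case by simp
  next
    case 2 show ?case using so_free_obj_codes by simp
  next
    case 3 show ?case using so_codes_syntax(2)[of p "Suc x" i j n] by auto
  }
next
  case (R_Add s t)
  {
    case 1 show ?case using R_Add by simp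
  next
    case 2 show ?case using R_Add(2)[of i n "n+2"] R_Add(5)[of i "n+1" "n+2"] by auto
  next
    case 3 show ?case using R_Add(3)[of i n "n+2"] R_Add(6)[of i "n+1" "n+2"] by auto
  }
next
  case (R_Mult s t)
  {
    case 1 show ?case using R_Mult by simp
  next
    case 2 show ?case using R_Mult(2)[of n j "n+1"] R_Mult(5)[of i n "n+1"] by auto
  next
    case 3 show ?case using R_Mult(3)[of n j "n+1"] R_Mult(6)[of i n "n+1"] by auto
  }
qed

lemma so_endo_syntax:
  "so_wf (so_endo p k)" "so_free_obj (so_endo p k) = {}" "so_free_pred (so_endo p k) \<subseteq> {(2, k)}"
proof -
  show "so_wf (so_endo p k)" by (simp add: so_endo_def)
  show "so_free_obj (so_endo p k) = {}"
    using so_free_obj_codes[of p k 0 1 2] so_free_obj_codes[of p k 0 1 3]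
      so_free_obj_codes[of p k 0 2 3] so_free_obj_codes[of p k 0 1 4]
      so_free_obj_codes[of p k 2 3 4] so_free_obj_codes[of p k 4 5 6]
    unfolding so_endo_def by auto
  show "so_free_pred (so_endo p k) \<subseteq> {(2, k)}"
    using so_codes_syntax(2)[of p k] by (simp add: so_endo_def)
qed

lemma so_of_ring_syntax:
  "so_wf (so_of_ring p \<phi>)"
  "so_free_obj (so_of_ring p \<phi>) = {}"
  "so_free_pred (so_of_ring p \<phi>) \<subseteq> (\<lambda>x. (2, Suc x)) ` ring_form_free \<phi>"
proof (induction \<phi>)
  case (R_Eq s t)
  {
    case 1 show ?case by (simp add: so_value_syntax)
  next
    case 2 show ?case using so_value_syntax(2)[of p s 0 1 2] so_value_syntax(2)[of p t 0 1 2] by auto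
  next
    case 3 show ?case using so_value_syntax(3)[of p s 0 1 2] so_value_syntax(3)[of p t 0 1 2] by auto
  }
next
  case (R_Ex x \<phi>)
  {
    case 1 show ?case using R_Ex by (simp add: so_endo_syntax)
  next
    case 2 show ?case using R_Ex by (simp add: so_endo_syntax)
  next
    case 3 show ?case using R_Ex(3) so_endo_syntax(3)[of p "Suc x"] by auto
  }
qed auto

lemma so_sentence_of_ring: "ring_sentence \<phi> \<Longrightarrow> so_sentence (so_of_ring p \<phi>)"
  using so_of_ring_syntax[of p \<phi>] by (simp add: so_sentence_def ring_sentence_def)

context abelian_p_group
begin

lemma so_sat_mul_add:
  assumes "i < m" "j < m" "k < m" "v j \<in> carrier G" "v k \<in> carrier G"
  shows "so_sat \<kappa> G (so_mul_add n i j k m) v P \<longleftrightarrow> v i = v j [^] n \<otimes> v k"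
  using assms
proof (induction n arbitrary: i m v)
  case 0
  then show ?case by simp
next
  case (Suc n)
  have "so_sat \<kappa> G (so_mul_add n m j k (Suc m)) (v(m := a)) P \<longleftrightarrow> a = v j [^] n \<otimes> v k" for a
    using Suc.IH[of m "Suc m" "v(m := a)"] Suc.prems by (simp add: fun_upd_def)
  then show ?case
    using Suc.prems by (auto simp: m_ac)
qed

lemma so_sat_codes:
  assumes "i < n" "j < n" "k > 0"
  shows "so_sat natLeq G (so_codes p k i j n) v P \<longleftrightarrow> codes (P 2 k) (v i) (v j)"
  using assms unfolding so_codes_def codes_def
  by (simp add: so_sat_mul_add)

definition represents :: "nat set \<Rightarrow> (nat \<Rightarrow> 'a \<Rightarrow> 'a) \<Rightarrow> (nat \<Rightarrow> nat \<Rightarrow> 'a list set) \<Rightarrow> bool" where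
  "represents W w P \<longleftrightarrow> (\<forall>x\<in>W. w x \<in> carrier (End_ring G) \<and>
     (\<forall>a\<in>carrier G. \<forall>b\<in>carrier G. codes (P 2 (Suc x)) a b \<longleftrightarrow> w x a = b))"

lemma ring_trm_val_in_End:
  assumes "represents (ring_trm_vars t) w P"
  shows "ring_trm_val (End_ring G) w t \<in> carrier (End_ring G)"
proof -
  interpret ring "End_ring G" by (rule ring_End_ring) (rule comm_group_axioms)
  show ?thesis using assms by (induction t) (auto simp: represents_def)
qed

lemma so_sat_value:
  assumes "represents (ring_trm_vars t) w P" "i < n" "j < n" "v i \<in> carrier G" "v j \<in> carrier G"
  shows "so_sat natLeq G (so_value p t i j n) v P \<longleftrightarrow> ring_trm_val (End_ring G) w t (v i) = v j"
  using assms
proof (induction t arbitrary: i j n v)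
  case (R_Var x)
  then show ?case by (simp add: so_sat_codes represents_def)
next
  case (R_Add s t)
  have rep: "represents (ring_trm_vars s) w P" "represents (ring_trm_vars t) w P"
    using R_Add.prems(1) by (auto simp: represents_def)
  have "ring_trm_val (End_ring G) w s (v i) \<in> carrier G"
    "ring_trm_val (End_ring G) w t (v i) \<in> carrier G"
    using rep[THEN ring_trm_val_in_End] R_Add.prems(4) by (auto simp: End_ring_def hom_def)
  moreover have "so_sat natLeq G (so_value p s i n (n+2)) (v(n := a, n+1 := b)) P \<longleftrightarrow>
        ring_trm_val (End_ring G) w s (v i) = a"
      "so_sat natLeq G (so_value p t i (n+1) (n+2)) (v(n := a, n+1 := b)) P \<longleftrightarrow>
        ring_trm_val (End_ring G) w t (v i) = b" if "a \<in> carrier G" "b \<in> carrier G" for a b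
    using R_Add.IH(1)[OF rep(1), of i "n+2" n "v(n := a, n+1 := b)"]
      R_Add.IH(2)[OF rep(2), of i "n+2" "n+1" "v(n := a, n+1 := b)"] R_Add.prems(2-5) that
    by (simp_all add: fun_upd_def)
  ultimately have "so_sat natLeq G (so_value p (R_Add s t) i j n) v P \<longleftrightarrow>
      v j = ring_trm_val (End_ring G) w s (v i) \<otimes> ring_trm_val (End_ring G) w t (v i)"
    using R_Add.prems(2,3) by (simp cong: bex_cong)
  then show ?case
    using R_Add.prems(4) by (auto simp: End_ring_def)
next
  case (R_Mult s t)
  have rep: "represents (ring_trm_vars s) w P" "represents (ring_trm_vars t) w P"
    using R_Mult.prems(1) by (auto simp: represents_def)
  have "ring_trm_val (End_ring G) w t (v i) \<in> carrier G"
    using rep(2)[THEN ring_trm_val_in_End] R_Mult.prems(4) by (auto simp: End_ring_def hom_def)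
  moreover have "so_sat natLeq G (so_value p t i n (n+1)) (v(n := a)) P \<longleftrightarrow>
        ring_trm_val (End_ring G) w t (v i) = a"
      "so_sat natLeq G (so_value p s n j (n+1)) (v(n := a)) P \<longleftrightarrow>
        ring_trm_val (End_ring G) w s a = v j" if "a \<in> carrier G" for a
    using R_Mult.IH(1)[OF rep(1), of n "n+1" j "v(n := a)"]
      R_Mult.IH(2)[OF rep(2), of i "n+1" n "v(n := a)"] R_Mult.prems(2-5) that
    by (simp_all add: fun_upd_def)
  ultimately have "so_sat natLeq G (so_value p (R_Mult s t) i j n) v P \<longleftrightarrow>
      ring_trm_val (End_ring G) w s (ring_trm_val (End_ring G) w t (v i)) = v j"
    by (simp cong: bex_cong)
  then show ?case
    using R_Mult.prems(4) by (simp add: End_ring_def compose_def)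
qed

lemma so_sat_endo:
  assumes "k > 0"
  shows "so_sat natLeq G (so_endo p k) v P \<longleftrightarrow>
     (\<exists>F\<in>carrier (End_ring G). \<forall>a\<in>carrier G. \<forall>b\<in>carrier G. codes (P 2 k) a b \<longleftrightarrow> F a = b)"
    (is "?lhs \<longleftrightarrow> ?rhs")
proof -
  let ?C = "codes (P 2 k)"
  have lhs: "?lhs \<longleftrightarrow> (\<forall>a\<in>carrier G. \<exists>b\<in>carrier G. ?C a b) \<and>
      (\<forall>a\<in>carrier G. \<forall>b\<in>carrier G. \<forall>c\<in>carrier G. ?C a b \<longrightarrow> ?C a c \<longrightarrow> b = c) \<and>
      (\<forall>a\<in>carrier G. \<forall>b\<in>carrier G. \<forall>c\<in>carrier G. \<forall>d\<in>carrier G.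
         ?C a b \<longrightarrow> ?C c d \<longrightarrow> ?C (a \<otimes> c) (b \<otimes> d))"
    using assms unfolding so_endo_def by (simp add: so_sat_codes)
  show ?thesis
  proof
    assume ?lhs
    then have L: "\<And>a. a \<in> carrier G \<Longrightarrow> \<exists>b\<in>carrier G. ?C a b"
      "\<And>a b c. \<lbrakk>a \<in> carrier G; b \<in> carrier G; c \<in> carrier G; ?C a b; ?C a c\<rbrakk> \<Longrightarrow> b = c"
      "\<And>a b c d. \<lbrakk>a \<in> carrier G; b \<in> carrier G; c \<in> carrier G; d \<in> carrier G; ?C a b; ?C c d\<rbrakk> \<Longrightarrow>
         ?C (a \<otimes> c) (b \<otimes> d)"
      unfolding lhs by blast+
    obtain f where f: "\<And>a. a \<in> carrier G \<Longrightarrow> f a \<in> carrier G \<and> ?C a (f a)" using L(1) by metis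
    let ?F = "restrict f (carrier G)"
    have "f (a \<otimes> b) = f a \<otimes> f b" if "a \<in> carrier G" "b \<in> carrier G" for a b
      using L(2)[of "a \<otimes> b"] L(3)[of a "f a" b "f b"] f that by simp
    then have "?F \<in> carrier (End_ring G)" using f by (auto simp: End_ring_def hom_def)
    moreover have "?C a b \<longleftrightarrow> ?F a = b" if "a \<in> carrier G" "b \<in> carrier G" for a b
      using f[of a] L(2)[of a b "f a"] that by auto
    ultimately show ?rhs by blast
  next
    assume ?rhs
    then obtain F where "F \<in> hom G G" "\<forall>a\<in>carrier G. \<forall>b\<in>carrier G. ?C a b \<longleftrightarrow> F a = b"
      by (auto simp: End_ring_def)
    then show ?lhs unfolding lhs by (auto simp: hom_def Pi_iff)
  qed
qed

text \<open>The quantifier over codes ranges over exactly the endomorphisms: the restriction of an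
  endomorphism to a countable \<open>B\<close> is an admissible value of a predicate variable and codes it, while \<open>so_endo\<close>
  ensures that every admitted code denotes an endomorphism.\<close>
lemma so_sat_of_ring:
  assumes red: "reduced_group G" and B: "B \<subseteq> carrier G" "|B| \<le>o natLeq"
    and decomp: "\<And>a. a \<in> carrier G \<Longrightarrow> \<exists>y\<in>carrier G. \<exists>b\<in>B. a = y [^] p \<otimes> b"
    and rep: "represents (ring_form_free \<phi>) w P"
  shows "so_sat natLeq G (so_of_ring p \<phi>) v P \<longleftrightarrow> ring_sat (End_ring G) \<phi> w"
  using rep
proof (induction \<phi> arbitrary: v w P)
  case (R_Eq s t)
  have rep: "represents (ring_trm_vars s) w P" "represents (ring_trm_vars t) w P"
    using R_Eq.prems by (auto simp: represents_def)
  let ?s = "ring_trm_val (End_ring G) w s" and ?t = "ring_trm_val (End_ring G) w t"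
  have st: "?s \<in> carrier (End_ring G)" "?t \<in> carrier (End_ring G)"
    using rep[THEN ring_trm_val_in_End] .
  have "so_sat natLeq G (so_of_ring p (R_Eq s t)) v P \<longleftrightarrow>
      (\<forall>a\<in>carrier G. \<exists>b\<in>carrier G. ?s a = b \<and> ?t a = b)"
    using rep by (simp add: so_sat_value)
  also have "\<dots> \<longleftrightarrow> (\<forall>a\<in>carrier G. ?s a = ?t a)"
    using st by (auto simp: End_ring_def hom_def Pi_iff)
  also have "\<dots> \<longleftrightarrow> ?s = ?t"
    using st by (auto simp: End_ring_def intro: extensionalityI)
  finally show ?case by simp
next
  case (R_Neg \<phi>)
  then show ?case by simp
next
  case (R_Conj \<phi> \<psi>)
  have "represents (ring_form_free \<phi>) w P" "represents (ring_form_free \<psi>) w P"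
    using R_Conj.prems by (auto simp: represents_def)
  then show ?case using R_Conj.IH by simp
next
  case (R_Ex x \<phi>)
  have upd: "represents (ring_form_free \<phi>) (w(x := F)) (P(2 := (P 2)(Suc x := b)))"
    if "F \<in> carrier (End_ring G)" "\<forall>a\<in>carrier G. \<forall>c\<in>carrier G. codes b a c \<longleftrightarrow> F a = c" for F b
    using R_Ex.prems that by (auto simp: represents_def)
  have code: "restriction_code B F \<subseteq> {as. length as = 2 \<and> set as \<subseteq> carrier G} \<and>
      |restriction_code B F| \<le>o natLeq \<and>
      (\<forall>a\<in>carrier G. \<forall>c\<in>carrier G. codes (restriction_code B F) a c \<longleftrightarrow> F a = c)"
    if F: "F \<in> carrier (End_ring G)" for F
  proof (intro conjI ballI)
    have hom: "F \<in> hom G G" using F by (simp add: End_ring_def)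
    show "restriction_code B F \<subseteq> {as. length as = 2 \<and> set as \<subseteq> carrier G}"
      using subsetD[OF B(1)] hom by (auto simp: restriction_code_def hom_def Pi_iff)
    show "|restriction_code B F| \<le>o natLeq"
      unfolding restriction_code_def using card_of_image B(2) ordLeq_transitive by blast
    fix a c assume "a \<in> carrier G" "c \<in> carrier G"
    then show "codes (restriction_code B F) a c \<longleftrightarrow> F a = c"
      using codes_imp_value[OF red hom] codes_value[OF hom B(1) decomp] by blast
  qed
  have "so_sat natLeq G (so_of_ring p (R_Ex x \<phi>)) v P \<longleftrightarrow>
      (\<exists>b. b \<subseteq> {as. length as = 2 \<and> set as \<subseteq> carrier G} \<and> |b| \<le>o natLeq \<and>
        (\<exists>F\<in>carrier (End_ring G). \<forall>a\<in>carrier G. \<forall>c\<in>carrier G. codes b a c \<longleftrightarrow> F a = c) \<and>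
        so_sat natLeq G (so_of_ring p \<phi>) v (P(2 := (P 2)(Suc x := b))))"
    by (simp add: so_sat_endo)
  also have "\<dots> \<longleftrightarrow> (\<exists>F\<in>carrier (End_ring G). ring_sat (End_ring G) \<phi> (w(x := F)))"
  proof
    assume "\<exists>F\<in>carrier (End_ring G). ring_sat (End_ring G) \<phi> (w(x := F))"
    then obtain F where F: "F \<in> carrier (End_ring G)" "ring_sat (End_ring G) \<phi> (w(x := F))" by blast
    have "so_sat natLeq G (so_of_ring p \<phi>) v (P(2 := (P 2)(Suc x := restriction_code B F)))"
      using R_Ex.IH[OF upd] F code[OF F(1)] by blast
    then show "\<exists>b. b \<subseteq> {as. length as = 2 \<and> set as \<subseteq> carrier G} \<and> |b| \<le>o natLeq \<and>
        (\<exists>F\<in>carrier (End_ring G). \<forall>a\<in>carrier G. \<forall>c\<in>carrier G. codes b a c \<longleftrightarrow> F a = c) \<and>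
        so_sat natLeq G (so_of_ring p \<phi>) v (P(2 := (P 2)(Suc x := b)))"
      using code[OF F(1)] F(1) by blast
  next
    assume "\<exists>b. b \<subseteq> {as. length as = 2 \<and> set as \<subseteq> carrier G} \<and> |b| \<le>o natLeq \<and>
        (\<exists>F\<in>carrier (End_ring G). \<forall>a\<in>carrier G. \<forall>c\<in>carrier G. codes b a c \<longleftrightarrow> F a = c) \<and>
        so_sat natLeq G (so_of_ring p \<phi>) v (P(2 := (P 2)(Suc x := b)))"
    then show "\<exists>F\<in>carrier (End_ring G). ring_sat (End_ring G) \<phi> (w(x := F))"
      using R_Ex.IH[OF upd] by blast
  qed
  finally show ?case by simp
qed

lemma so_true_of_ring:
  assumes red: "reduced_group G" and basic: "\<And>B. basic_subgroup B G \<Longrightarrow> |B| =o natLeq"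
    and \<phi>: "ring_sentence \<phi>"
  shows "so_of_ring p \<phi> \<in> Th2 natLeq G \<longleftrightarrow> ring_true (End_ring G) \<phi>"
proof -
  obtain B where B: "basic_subgroup B G"
    and decomp: "\<And>a. a \<in> carrier G \<Longrightarrow> \<exists>y\<in>carrier G. \<exists>b\<in>B. a = y [^] p \<otimes> b"
    using ex_basic_subgroup by blast
  have BC: "B \<subseteq> carrier G" using B subgroup.subset unfolding basic_subgroup_def by blast
  have sat: "so_sat natLeq G (so_of_ring p \<phi>) v P \<longleftrightarrow> ring_sat (End_ring G) \<phi> w" for v P w
    by (rule so_sat_of_ring[OF red BC ordIso_imp_ordLeq[OF basic[OF B]] decomp])
      (use \<phi> in \<open>auto simp: represents_def ring_sentence_def\<close>)
  interpret End: ring "End_ring G" by (rule ring_End_ring) (rule comm_group_axioms)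
  have ne: "range (\<lambda>_::nat. \<one>) \<subseteq> carrier G" "range (\<lambda>_::nat. \<zero>\<^bsub>End_ring G\<^esub>) \<subseteq> carrier (End_ring G)"
    by auto
  have "so_true natLeq G (so_of_ring p \<phi>) \<longleftrightarrow> ring_true (End_ring G) \<phi>"
  proof
    assume "so_true natLeq G (so_of_ring p \<phi>)"
    then have "so_sat natLeq G (so_of_ring p \<phi>) (\<lambda>_. \<one>) P" for P
      using ne(1) unfolding so_true_def by blast
    then show "ring_true (End_ring G) \<phi>" using sat unfolding ring_true_def by blast
  next
    assume "ring_true (End_ring G) \<phi>"
    then have "ring_sat (End_ring G) \<phi> (\<lambda>_. \<zero>\<^bsub>End_ring G\<^esub>)"
      using ne(2) unfolding ring_true_def by blast
    then show "so_true natLeq G (so_of_ring p \<phi>)" using sat unfolding so_true_def by blast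
  qed
  then show ?thesis using so_sentence_of_ring[OF \<phi>] by (simp add: Th2_def)
qed

end

theorem theorem3:
  fixes p :: nat
    and A1 :: "('a, 'm) monoid_scheme"
    and A2 :: "('b, 'n) monoid_scheme"
  assumes "Factorial_Ring.prime p"
    and "comm_group A1" and "p_group p A1" and "reduced_group A1"
    and "\<And>B. basic_subgroup B A1 \<Longrightarrow> |B| =o natLeq"
    and "comm_group A2" and "p_group p A2" and "reduced_group A2"
    and "\<And>B. basic_subgroup B A2 \<Longrightarrow> |B| =o natLeq"
    and "Th2 natLeq A1 = Th2 natLeq A2"
  shows "elementarily_equivalent (End_ring A1) (End_ring A2)"
proof -
  interpret A1: abelian_p_group A1 p by (rule abelian_p_groupI) fact+
  interpret A2: abelian_p_group A2 p by (rule abelian_p_groupI) fact+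
  show ?thesis
    unfolding elementarily_equivalent_def
    using A1.so_true_of_ring[OF assms(4,5)] A2.so_true_of_ring[OF assms(8,9)] assms(10) by simp
qed

end
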